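(* Suppose that $V=\oplus_{q\in\frac12\mathbb{Z}}V_{(q)}$ is a simple vertex operator superalgebra such that $V_{(\frac32)}+V_{(2)}$ strongly generates $V$. Then $$a_0b=\tfrac12L(-1)a_1b\quad\text{for all }a,b\in V_{(2)}.$$
   Context: A vertex operator superalgebra is $(V,Y,\mathbf 1,\omega)$ with $V=\oplus_{q\in\frac12\mathbb{Z}}V_{(q)}$ a complex vector space with parity decomposition $V^{\bar0}=\oplus_{n\in\mathbb{Z}}V_{(n)}$, $V^{\bar1}=\oplus_{n\in\mathbb{Z}}V_{(n+\frac12)}$, a linear map $Y(v,z)=\sum_n v_nz^{-n-1}\in(\mathrm{End}\,V)[[z,z^{-1}]]$, and even vectors $\mathbf 1,\omega$, such that: $u_nv\in V^{\alpha+\beta}$ for $u\in V^\alpha,v\in V^\beta$ and $u_nv=0$ for $n$ large; for parity-homogeneous $u,v$ and $m,n,k\in\mathbb{Z}$, $\sum_{i\ge0}(-1)^i\binom mi(u_{m+k-i}v_{n+i}-(-1)^{|u||v|}(-1)^mv_{m+n-i}u_{k+i})=\sum_{i\ge0}\binom ki(u_{m+i}v)_{n+k-i}$ (Jacobi identity); $\mathbf 1_mv=\delta_{m,-1}v$, $v_{-1}\mathbf 1=v$, $v_n\mathbf 1=0$ for $n\ge0$; $L(n)=\omega_{n+1}$ satisfy $[L(m),L(n)]=(m-n)L(m+n)+\frac{m^3-m}{12}\delta_{m+n,0}c_V$ for some $c_V\in\mathbb{C}$; $Y(L(-1)v,z)=\frac{d}{dz}Y(v,z)$; $V_{(q)}=\{v: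 L(0)v=qv\}$; $\dim V_{(q)}<\infty$ for all $q$ and $V_{(q)}=0$ for $q$ sufficiently negative. $V$ is strongly generated by a subset $T$ if $V$ is spanned by $\mathbf 1$ and the vectors $a^{(1)}_{-n_1}\cdots a^{(r)}_{-n_r}\mathbf 1$ with $r\ge1$, $a^{(i)}\in T$, $n_i$ positive integers. An ideal is a subspace $I$ with $v_nI\subset I$ and $x_nv\in I$ for all $v\in V$, $x\in I$, $n\in\mathbb{Z}$; $V$ is simple if $V\neq0$ and its only ideals are $0$ and $V$. *)

theory Defs
  imports Complex_Main "HOL-Library.Z2" "HOL-Library.Groups_Big_Fun"
begin

text \<open>
  The underlying space of a superalgebra is a type \<open>'v\<close> with a complex scalar multiplication
  \<open>scale\<close>. A field \<open>Y(u,z) = \<Sum>n. u\<^sub>n z\<^bsup>-n-1\<^esup>\<close> is given by its modes: \<open>Y u n v\<close> is \<open>u\<^sub>n v\<close>.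
  The weight space of weight \<open>q\<close> is \<open>V q\<close>; only its values at half-integers \<open>q\<close> are meaningful.
  All sums over \<open>i \<ge> 0\<close> below have finite support by the truncation axiom, so \<open>Sum_any\<close> computes
  them.
\<close>

definition half_ints :: "rat set" where
  "half_ints = range (\<lambda>k::int. of_int k / 2)"

definition is_direct_sum ::
  "(complex \<Rightarrow> 'v::ab_group_add \<Rightarrow> 'v) \<Rightarrow> 'q set \<Rightarrow> ('q \<Rightarrow> 'v set) \<Rightarrow> bool" where
  "is_direct_sum scale Q V \<longleftrightarrow>
     (\<forall>q\<in>Q. module.subspace scale (V q)) \<and>
     (\<forall>v. \<exists>!f. finite {q. f q \<noteq> 0} \<and> (\<forall>q\<in>Q. f q \<in> V q) \<and> (\<forall>q. q \<notin> Q \<longrightarrow> f q = 0) \<and>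
        v = Sum_any f)"

text \<open>The parity group \<open>\<int>/2\<int>\<close> is the type \<open>bit\<close>.\<close>

definition parity_part ::
  "(complex \<Rightarrow> 'v::ab_group_add \<Rightarrow> 'v) \<Rightarrow> (rat \<Rightarrow> 'v set) \<Rightarrow> bit \<Rightarrow> 'v set" where
  "parity_part scale V \<alpha> =
     (if \<alpha> = 0 then module.span scale (\<Union>n::int. V (of_int n))
      else module.span scale (\<Union>n::int. V (of_int n + 1/2)))"

definition super_sign :: "bit \<Rightarrow> bit \<Rightarrow> complex" where
  "super_sign \<alpha> \<beta> = (if \<alpha> * \<beta> = 0 then 1 else - 1)"

definition Vir :: "('v \<Rightarrow> int \<Rightarrow> 'v \<Rightarrow> 'v) \<Rightarrow> 'v \<Rightarrow> int \<Rightarrow> 'v \<Rightarrow> 'v" where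
  "Vir Y \<omega> n = Y \<omega> (n + 1)"

locale vertex_operator_superalgebra = vector_space scale
  for scale :: "complex \<Rightarrow> 'v::ab_group_add \<Rightarrow> 'v" +
  fixes V :: "rat \<Rightarrow> 'v set"
    and Y :: "'v \<Rightarrow> int \<Rightarrow> 'v \<Rightarrow> 'v"
    and vac :: 'v
    and \<omega> :: 'v
  assumes grading: "is_direct_sum scale half_ints V"
    and Y_linear_left: "\<And>n v. Vector_Spaces.linear scale scale (\<lambda>u. Y u n v)"
    and Y_linear_right: "\<And>u n. Vector_Spaces.linear scale scale (Y u n)"
    and vac_even: "vac \<in> parity_part scale V 0"
    and conformal_even: "\<omega> \<in> parity_part scale V 0"
    and Y_parity: "\<And>\<alpha> \<beta> u v n. u \<in> parity_part scale V \<alpha> \<Longrightarrow> v \<in> parity_part scale V \<beta>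
          \<Longrightarrow> Y u n v \<in> parity_part scale V (\<alpha> + \<beta>)"
    and truncation: "\<And>u v. \<exists>N. \<forall>n\<ge>N. Y u n v = 0"
    and jacobi: "\<And>\<alpha> \<beta> u v w m n k.
          u \<in> parity_part scale V \<alpha> \<Longrightarrow> v \<in> parity_part scale V \<beta> \<Longrightarrow>
          Sum_any (\<lambda>i::nat. scale ((- 1) ^ i * (of_int m gchoose i))
            (Y u (m + k - int i) (Y v (n + int i) w)
             - scale (super_sign \<alpha> \<beta> * (- 1) powi m)
                 (Y v (m + n - int i) (Y u (k + int i) w))))
          = Sum_any (\<lambda>i::nat. scale (of_int k gchoose i)
              (Y (Y u (m + int i) v) (n + k - int i) w))"
    and vac_mode: "\<And>m v. Y vac m v = (if m = - 1 then v else 0)"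
    and creation: "\<And>v. Y v (- 1) vac = v"
    and vac_annihilated: "\<And>v n. n \<ge> 0 \<Longrightarrow> Y v n vac = 0"
    and virasoro: "\<exists>c::complex. \<forall>m n v.
          Vir Y \<omega> m (Vir Y \<omega> n v) - Vir Y \<omega> n (Vir Y \<omega> m v)
          = scale (of_int (m - n)) (Vir Y \<omega> (m + n) v)
            + scale (if m + n = 0 then (of_int m ^ 3 - of_int m) / 12 * c else 0) v"
    and derivative: "\<And>v n w. Y (Vir Y \<omega> (- 1) v) n w = scale (- of_int n) (Y v (n - 1) w)"
    and weight_space: "\<And>q. q \<in> half_ints \<Longrightarrow> V q = {v. Vir Y \<omega> 0 v = scale (of_rat q) v}"
    and finite_dim: "\<And>q. q \<in> half_ints \<Longrightarrow> \<exists>B. finite B \<and> V q = span B"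
    and bounded_below: "\<exists>N. \<forall>q\<in>half_ints. q < N \<longrightarrow> V q = {0}"

definition strongly_generates ::
  "(complex \<Rightarrow> 'v::ab_group_add \<Rightarrow> 'v) \<Rightarrow> ('v \<Rightarrow> int \<Rightarrow> 'v \<Rightarrow> 'v) \<Rightarrow> 'v \<Rightarrow> 'v set \<Rightarrow> bool" where
  "strongly_generates scale Y vac T \<longleftrightarrow>
     module.span scale
       (insert vac {foldr (\<lambda>(a, n). Y a (- n)) xs vac | xs.
          xs \<noteq> [] \<and> set xs \<subseteq> T \<times> {n::int. n > 0}}) = UNIV"

definition vosa_ideal ::
  "(complex \<Rightarrow> 'v::ab_group_add \<Rightarrow> 'v) \<Rightarrow> ('v \<Rightarrow> int \<Rightarrow> 'v \<Rightarrow> 'v) \<Rightarrow> 'v set \<Rightarrow> bool" where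
  "vosa_ideal scale Y I \<longleftrightarrow>
     module.subspace scale I \<and> (\<forall>v n. \<forall>x\<in>I. Y v n x \<in> I \<and> Y x n v \<in> I)"

definition vosa_simple ::
  "(complex \<Rightarrow> 'v::ab_group_add \<Rightarrow> 'v) \<Rightarrow> ('v \<Rightarrow> int \<Rightarrow> 'v \<Rightarrow> 'v) \<Rightarrow> bool" where
  "vosa_simple scale Y \<longleftrightarrow>
     (UNIV :: 'v set) \<noteq> {0} \<and> (\<forall>I. vosa_ideal scale Y I \<longrightarrow> I = {0} \<or> I = UNIV)"

end

theory Submission
  imports Defs
begin

text \<open>
  Fix \<open>a, b \<in> V\<^sub>(\<^sub>2\<^sub>)\<close>. The claim is that the vector \<open>c = a\<^sub>0b - (1/2) L(-1) a\<^sub>1b\<close> of weight \<open>3\<close> vanishes.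
  The generators have weight at least \<open>3/2\<close>, so the only nonzero weight spaces of weight below
  \<open>3/2\<close> are those of weight \<open>0\<close>, and \<open>V\<^sub>(\<^sub>0\<^sub>)\<close> is spanned by the vacuum; moreover
  \<open>V\<^sub>(\<^sub>5\<^sub>/\<^sub>2\<^sub>) = L(-1) V\<^sub>(\<^sub>3\<^sub>/\<^sub>2\<^sub>)\<close>, and \<open>V\<^sub>(\<^sub>3\<^sub>)\<close> is spanned by \<open>L(-1) V\<^sub>(\<^sub>2\<^sub>)\<close> and the products
  \<open>x\<^sub>-\<^sub>1y\<close> with \<open>x, y \<in> V\<^sub>(\<^sub>3\<^sub>/\<^sub>2\<^sub>)\<close> (\<open>weight_space_low_generators\<close>).

  In a simple algebra with \<open>V\<^sub>(\<^sub>1\<^sub>) = 0\<close> the invariant bilinear form is nondegenerate, so it would be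
  enough that \<open>c\<close> is orthogonal to \<open>V\<^sub>(\<^sub>3\<^sub>)\<close>. The proof follows this idea, but replaces the form by
  the coefficient of the vacuum: let \<open>K\<close> be the sum of all weight spaces of nonzero weight. If
  \<open>c\<^sub>nu \<in> K\<close> for all \<open>u\<close> and \<open>n\<close>, then by skew symmetry the span of all \<open>u\<^sub>nc\<close> also lies in \<open>K\<close>.
  This span is the ideal generated by \<open>c\<close>; it misses the vacuum, so it is \<open>0\<close> by simplicity, and it
  contains \<open>c\<close> (\<open>obstruction_zero\<close>).

  To prove \<open>c\<^sub>nu \<in> K\<close>, note that \<open>c\<close> is quasi-primary, that is, \<open>L(1)c = 0\<close>. Since
  \<open>L(1)V \<subseteq> K\<close>, commuting \<open>L(1)\<close> past modes of \<open>c\<close> reduces a vector \<open>u\<close> of weight other than \<open>3\<close>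
  to \<open>L(1)u\<close> (\<open>quasi_primary_orthogonality\<close>), so that only \<open>u \<in> V\<^sub>(\<^sub>3\<^sub>)\<close> matters. A vector
  \<open>u = L(-1)v\<close> is harmless because \<open>L(-1)V \<subseteq> K\<close>. For \<open>u = x\<^sub>-\<^sub>1y\<close> the commutator formula leaves the
  terms \<open>(c\<^sub>ix)\<^sub>jy\<close>.

  The decisive fact is \<open>c\<^sub>2x = 0\<close> for \<open>x \<in> V\<^sub>(\<^sub>3\<^sub>/\<^sub>2\<^sub>)\<close> (\<open>obstruction_mode_2_odd\<close>). On the one hand the
  commutator formula gives \<open>c\<^sub>2x = [a\<^sub>1, b\<^sub>1]x\<close>; on the other hand, computing \<open>x\<^sub>2c\<close> directly and
  antisymmetrizing in \<open>a\<close> and \<open>b\<close> gives \<open>x\<^sub>2c = -(2/3) [a\<^sub>1, b\<^sub>1]x\<close>; and \<open>x\<^sub>2c = - c\<^sub>2x\<close> by skew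
  symmetry. These are only compatible if \<open>[a\<^sub>1, b\<^sub>1]x = 0\<close>. It follows that \<open>c\<^sub>1x = 0\<close>, because
  \<open>V\<^sub>(\<^sub>5\<^sub>/\<^sub>2\<^sub>)\<close> contains no quasi-primary vector other than \<open>0\<close>, and then that \<open>c\<^sub>0x\<close> is quasi-primary
  of weight \<open>7/2\<close>, hence orthogonal to \<open>y\<close>.
\<close>

section \<open>Linearity of modes\<close>

context vertex_operator_superalgebra
begin

abbreviation L :: "int \<Rightarrow> 'v \<Rightarrow> 'v" where
  "L n \<equiv> Vir Y \<omega> n"

abbreviation P :: "bit \<Rightarrow> 'v set" where
  "P \<alpha> \<equiv> parity_part scale V \<alpha>"

lemma mode_add_left: "Y (u + u') n v = Y u n v + Y u' n v"
proof -
  interpret l: Vector_Spaces.linear scale scale "\<lambda>u. Y u n v" by (rule Y_linear_left)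
  show ?thesis by (rule l.add)
qed

lemma mode_scale_left: "Y (scale z u) n v = scale z (Y u n v)"
proof -
  interpret l: Vector_Spaces.linear scale scale "\<lambda>u. Y u n v" by (rule Y_linear_left)
  show ?thesis by (rule l.scale)
qed

lemma mode_diff_left: "Y (u - u') n v = Y u n v - Y u' n v"
proof -
  interpret l: Vector_Spaces.linear scale scale "\<lambda>u. Y u n v" by (rule Y_linear_left)
  show ?thesis by (rule l.diff)
qed

lemma mode_zero_left [simp]: "Y 0 n v = 0"
  using mode_diff_left[of 0 0 n v] by simp

lemma mode_add_right: "Y u n (v + v') = Y u n v + Y u n v'"
proof -
  interpret l: Vector_Spaces.linear scale scale "Y u n" by (rule Y_linear_right)
  show ?thesis by (rule l.add)
qed

lemma mode_scale_right: "Y u n (scale z v) = scale z (Y u n v)"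
proof -
  interpret l: Vector_Spaces.linear scale scale "Y u n" by (rule Y_linear_right)
  show ?thesis by (rule l.scale)
qed

lemma mode_diff_right: "Y u n (v - v') = Y u n v - Y u n v'"
proof -
  interpret l: Vector_Spaces.linear scale scale "Y u n" by (rule Y_linear_right)
  show ?thesis by (rule l.diff)
qed

lemma mode_zero_right [simp]: "Y u n 0 = 0"
  using mode_diff_right[of u n 0 0] by simp

lemmas mode_linear = mode_add_left mode_scale_left mode_diff_left
  mode_add_right mode_scale_right mode_diff_right

lemma L_zero [simp]: "L n 0 = 0"
  by (simp add: Vir_def)

lemma L_scale: "L n (scale z v) = scale z (L n v)"
  by (simp add: Vir_def mode_linear)

lemma subspace_mode_preimage_left:
  assumes "subspace S"
  shows "subspace {u. Y u n v \<in> S}"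
  using assms by (auto simp: subspace_def mode_linear)

lemma subspace_mode_preimage_right:
  assumes "subspace S"
  shows "subspace {v. Y u n v \<in> S}"
  using assms by (auto simp: subspace_def mode_linear)

text \<open>
  On a family of infinite support \<open>Sum_any\<close> is \<open>0\<close>, which lies in every subspace. So the infinite sums
  of the Jacobi identity can be placed in a subspace without first bounding their range.
\<close>

lemma Sum_any_in_subspace:
  assumes "subspace S" and "\<And>i. f i \<in> S"
  shows "Sum_any f \<in> S"
  unfolding Sum_any.expand_set using assms by (intro subspace_sum) auto

section \<open>The weight grading and the parity\<close>

lemma half_ints_of_int [simp]: "of_int k \<in> half_ints"
  unfolding half_ints_def by (rule range_eqI[of _ _ "2 * k"]) simp

lemma half_ints_0 [simp]: "0 \<in> half_ints"
  using half_ints_of_int[of 0] by simp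

lemma half_ints_1 [simp]: "1 \<in> half_ints"
  using half_ints_of_int[of 1] by simp

lemma half_ints_numeral [simp]: "numeral k \<in> half_ints"
  using half_ints_of_int[of "numeral k"] by simp

lemma half_ints_half [simp]: "numeral k / 2 \<in> half_ints"
  unfolding half_ints_def by (rule range_eqI[of _ _ "numeral k"]) simp

lemma half_ints_half1 [simp]: "1 / 2 \<in> half_ints"
  unfolding half_ints_def by (rule range_eqI[of _ _ 1]) simp

lemma half_ints_add [simp]: "p \<in> half_ints \<Longrightarrow> q \<in> half_ints \<Longrightarrow> p + q \<in> half_ints"
  unfolding half_ints_def
proof (elim rangeE)
  fix k l assume "p = of_int k / 2" "q = of_int l / 2"
  then show "p + q \<in> range (\<lambda>k::int. of_int k / 2)"
    by (intro range_eqI[of _ _ "k + l"]) (simp add: add_divide_distrib)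
qed

lemma half_ints_minus [simp]: "p \<in> half_ints \<Longrightarrow> - p \<in> half_ints"
  unfolding half_ints_def
proof (elim rangeE)
  fix k assume "p = of_int k / 2"
  then show "- p \<in> range (\<lambda>k::int. of_int k / 2)"
    by (intro range_eqI[of _ _ "- k"]) simp
qed

lemma half_ints_diff [simp]: "p \<in> half_ints \<Longrightarrow> q \<in> half_ints \<Longrightarrow> p - q \<in> half_ints"
  using half_ints_add[of p "- q"] by simp

lemma weight_subspace: "q \<in> half_ints \<Longrightarrow> subspace (V q)"
  using grading unfolding is_direct_sum_def by blast

lemma span_weight_spaces: "span (\<Union>q\<in>half_ints. V q) = UNIV"
proof -
  have "v \<in> span (\<Union>q\<in>half_ints. V q)" for v
  proof -
    obtain f where f: "\<forall>q\<in>half_ints. f q \<in> V q" "\<forall>q. q \<notin> half_ints \<longrightarrow> f q = 0" "v = Sum_any f"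
      using grading unfolding is_direct_sum_def by metis
    have "f q \<in> span (\<Union>q\<in>half_ints. V q)" for q
      using f(1,2) by (cases "q \<in> half_ints") (auto intro: span_base span_zero)
    then show ?thesis
      unfolding f(3) by (intro Sum_any_in_subspace subspace_span)
  qed
  then show ?thesis by auto
qed

text \<open>
  This is the uniqueness half of the direct sum. A vector in the span of the other weight spaces has
  a decomposition with component \<open>0\<close> at \<open>p\<close>, and a vector of \<open>V p\<close> has one concentrated at \<open>p\<close>.
\<close>

lemma weight_space_independent:
  assumes p: "p \<in> half_ints" and v: "v \<in> V p"
    and span: "v \<in> span (\<Union>q\<in>half_ints - {p}. V q)"
  shows "v = 0"
proof -
  define D where "D v f \<longleftrightarrow> finite {q. f q \<noteq> 0} \<and> (\<forall>q\<in>half_ints. f q \<in> V q) \<and>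
      (\<forall>q. q \<notin> half_ints \<longrightarrow> f q = 0) \<and> v = Sum_any f" for v :: 'v and f
  have uniq: "f = g" if "D v f" "D v g" for v f g
    using grading that unfolding is_direct_sum_def D_def by metis
  have V0: "0 \<in> V q" if "q \<in> half_ints" for q
    using weight_subspace[OF that] by (rule subspace_0)
  have single: "D w (\<lambda>r. if r = q then w else 0)" if "q \<in> half_ints" "w \<in> V q" for q w
    using that V0 unfolding D_def by (auto simp: Sum_any.delta)
  have "\<exists>f. D v f \<and> f p = 0"
    using span
  proof (rule span_induct)
    show "\<exists>f. D v f \<and> f p = 0" if "v \<in> (\<Union>q\<in>half_ints - {p}. V q)" for v
      using that single by fastforce
    have "\<exists>f. D 0 f \<and> f p = 0"
      using V0 by (intro exI[of _ "\<lambda>_. 0"]) (simp add: D_def)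
    moreover have "\<exists>h. D (x + y) h \<and> h p = 0" if "D x f" "f p = 0" "D y g" "g p = 0" for x y f g
    proof (intro exI conjI)
      have "finite {q. f q + g q \<noteq> 0}"
        by (rule finite_subset[of _ "{q. f q \<noteq> 0} \<union> {q. g q \<noteq> 0}"]) (use that in \<open>auto simp: D_def\<close>)
      then show "D (x + y) (\<lambda>q. f q + g q)"
        using that weight_subspace unfolding D_def by (auto simp: Sum_any.distrib subspace_def)
      show "f p + g p = 0" using that by simp
    qed
    moreover have "\<exists>h. D (scale z x) h \<and> h p = 0" if "D x f" "f p = 0" for x f z
    proof (intro exI conjI)
      have fin: "finite {q. f q \<noteq> 0}" using that by (simp add: D_def)
      have sub: "{q. scale z (f q) \<noteq> 0} \<subseteq> {q. f q \<noteq> 0}" by auto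
      have "Sum_any (\<lambda>q. scale z (f q)) = scale z (Sum_any f)"
        unfolding Sum_any.expand_superset[OF fin sub] Sum_any.expand_superset[OF fin subset_refl]
        by (simp add: scale_sum_right)
      then show "D (scale z x) (\<lambda>q. scale z (f q))"
        using that weight_subspace finite_subset[OF sub fin]
        unfolding D_def by (auto simp: subspace_def)
      show "scale z (f p) = 0" using that by simp
    qed
    ultimately show "subspace {v. \<exists>f. D v f \<and> f p = 0}"
      unfolding subspace_def by blast
  qed
  then obtain f where f: "D v f" "f p = 0" by blast
  have "f = (\<lambda>r. if r = p then v else 0)"
    by (rule uniq[OF f(1) single[OF p v]])
  then show ?thesis using f(2) by (auto dest: fun_cong[of _ _ p])
qed

text \<open>
  Homogeneous vectors that span the whole space span it weight by weight: in an expansion of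
  \<open>v \<in> V p\<close>, the terms of weight other than \<open>p\<close> add up to a vector of \<open>V p\<close> that is also in the
  span of the other weight spaces, hence to \<open>0\<close>.
\<close>

lemma weight_space_generated:
  assumes G: "\<And>q. q \<in> half_ints \<Longrightarrow> G q \<subseteq> V q"
    and gen: "span (\<Union>q\<in>half_ints. G q) = UNIV"
    and p: "p \<in> half_ints"
  shows "V p = span (G p)"
proof
  show "span (G p) \<subseteq> V p"
    using G[OF p] weight_subspace[OF p] by (simp add: span_minimal)
  show "V p \<subseteq> span (G p)"
  proof
    fix v assume v: "v \<in> V p"
    have "(\<Union>q\<in>half_ints. G q) = G p \<union> (\<Union>q\<in>half_ints - {p}. G q)"
      using p by auto
    then have "v \<in> span (G p \<union> (\<Union>q\<in>half_ints - {p}. G q))"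
      using gen by auto
    then obtain g r where g: "g \<in> span (G p)" and r: "r \<in> span (\<Union>q\<in>half_ints - {p}. G q)"
      and vgr: "v = g + r"
      unfolding span_Un by blast
    have "r = v - g" using vgr by simp
    moreover have "g \<in> V p" using g \<open>span (G p) \<subseteq> V p\<close> by auto
    ultimately have "r \<in> V p" using v weight_subspace[OF p] by (simp add: subspace_diff)
    moreover have "r \<in> span (\<Union>q\<in>half_ints - {p}. V q)"
      using r by (rule rev_subsetD) (intro span_mono, use G in blast)
    ultimately have "r = 0" by (rule weight_space_independent[OF p])
    then show "v \<in> span (G p)" using vgr g by simp
  qed
qed

lemma even_weight: "V (of_int k) \<subseteq> P 0"
  unfolding parity_part_def by (auto intro: span_base)

lemma odd_weight: "V (of_int k + 1/2) \<subseteq> P 1"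
  unfolding parity_part_def by (auto intro: span_base)

lemma weight_parity:
  assumes "q \<in> half_ints"
  obtains \<alpha> where "V q \<subseteq> P \<alpha>"
proof -
  obtain k where k: "q = of_int k / 2" using assms unfolding half_ints_def by blast
  show ?thesis
  proof (cases "even k")
    case True
    then obtain l where "k = 2 * l" by blast
    then have "q = of_int l" using k by simp
    then show ?thesis using even_weight that by blast
  next
    case False
    then obtain l where "k = 2 * l + 1" by (rule oddE)
    then have "q = of_int l + 1/2" using k by (simp add: add_divide_distrib)
    then show ?thesis using odd_weight that by blast
  qed
qed

lemma subspace_contains_by_weight:
  assumes S: "subspace S" and "\<And>q v. q \<in> half_ints \<Longrightarrow> v \<in> V q \<Longrightarrow> v \<in> S"
  shows "v \<in> S"
proof -
  have "span (\<Union>q\<in>half_ints. V q) \<subseteq> S"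
    using assms by (intro span_minimal) auto
  then show ?thesis using span_weight_spaces by auto
qed

lemma subspace_contains_by_parity:
  assumes S: "subspace S" and *: "\<And>\<alpha> v. v \<in> P \<alpha> \<Longrightarrow> v \<in> S"
  shows "v \<in> S"
  using S
proof (rule subspace_contains_by_weight)
  fix q v assume "q \<in> half_ints" "v \<in> V q"
  then show "v \<in> S" using * by (meson subsetD weight_parity)
qed

section \<open>Commutators and the Virasoro modes\<close>

text \<open>
  The Jacobi identity at \<open>m = 0\<close>, where only the term \<open>i = 0\<close> survives on the left-hand side.
\<close>

lemma super_commutator:
  assumes "u \<in> P \<alpha>" "v \<in> P \<beta>"
  shows "Y u k (Y v n w) = scale (super_sign \<alpha> \<beta>) (Y v n (Y u k w)) +
    Sum_any (\<lambda>i. scale (of_int k gchoose i) (Y (Y u (int i) v) (n + k - int i) w))"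
proof -
  have "Sum_any (\<lambda>i::nat. scale ((- 1) ^ i * (of_int 0 gchoose i))
            (Y u (0 + k - int i) (Y v (n + int i) w)
             - scale (super_sign \<alpha> \<beta> * (- 1) powi 0)
                 (Y v (0 + n - int i) (Y u (k + int i) w))))
     = Sum_any (\<lambda>i::nat. if i = 0 then Y u k (Y v n w)
             - scale (super_sign \<alpha> \<beta>) (Y v n (Y u k w)) else 0)"
    by (rule Sum_any.cong) (auto simp: gbinomial_0_left)
  with jacobi[OF assms, where m = 0 and n = n and k = k and w = w] show ?thesis
    by (simp add: Sum_any.delta algebra_simps)
qed

lemma super_commutator_nonneg:
  assumes "u \<in> P \<alpha>" "v \<in> P \<beta>"
  shows "Y u (int k) (Y v n w) = scale (super_sign \<alpha> \<beta>) (Y v n (Y u (int k) w)) +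
    (\<Sum>i\<le>k. scale (of_nat (k choose i)) (Y (Y u (int i) v) (n + int k - int i) w))"
proof -
  have "Sum_any (\<lambda>i. scale (of_int (int k) gchoose i) (Y (Y u (int i) v) (n + int k - int i) w)) =
     Sum_any (\<lambda>i. scale (of_nat (k choose i)) (Y (Y u (int i) v) (n + int k - int i) w))"
    by (simp add: binomial_gbinomial)
  also have "\<dots> = (\<Sum>i\<le>k. scale (of_nat (k choose i)) (Y (Y u (int i) v) (n + int k - int i) w))"
    by (rule Sum_any.expand_superset) (auto intro!: binomial_eq_0 simp: not_le[symmetric] intro: ccontr)
  finally show ?thesis
    using super_commutator[OF assms, of "int k" n w] by simp
qed

lemma super_sign_simps [simp]: "super_sign 0 \<alpha> = 1" "super_sign \<alpha> 0 = 1"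
  by (simp_all add: super_sign_def)

text \<open>
  The commutator formula for \<open>\<omega>\<close>, with the products \<open>\<omega>\<^sub>0u = L(-1)u\<close>, \<open>\<omega>\<^sub>1u = p u\<close> and
  \<open>\<omega>\<^sub>2u = L(1)u\<close>, and the derivative property to turn modes of \<open>L(-1)u\<close> into modes of \<open>u\<close>.
\<close>

lemma L_commutator:
  assumes "p \<in> half_ints" "u \<in> V p"
  shows "L (-1) (Y u n w) = Y u n (L (-1) w) + scale (- of_int n) (Y u (n - 1) w)"
    and "L 0 (Y u n w) = Y u n (L 0 w) + scale (of_rat p - of_int n - 1) (Y u n w)"
    and "L 1 (Y u n w) = Y u n (L 1 w) + scale (2 * of_rat p - 2 - of_int n) (Y u (n + 1) w)
           + Y (L 1 u) n w"
proof -
  obtain \<alpha> where u: "u \<in> P \<alpha>" using weight_parity assms by (metis subsetD)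
  have L0: "Y \<omega> 1 u = scale (of_rat p) u"
    using assms weight_space[of p] by (auto simp: Vir_def)
  have Lm: "Y (Y \<omega> 0 u) m v = scale (- of_int m) (Y u (m - 1) v)" for m v
    using derivative[of u m v] by (simp add: Vir_def)
  note c = super_commutator_nonneg[OF conformal_even u]
  show "L (-1) (Y u n w) = Y u n (L (-1) w) + scale (- of_int n) (Y u (n - 1) w)"
    using c[of 0 n w] by (simp add: Vir_def Lm)
  show "L 0 (Y u n w) = Y u n (L 0 w) + scale (of_rat p - of_int n - 1) (Y u n w)"
    using c[of 1 n w]
    by (simp add: Vir_def Lm L0 mode_linear scale_left_distrib scale_left_diff_distrib)
  show "L 1 (Y u n w) = Y u n (L 1 w) + scale (2 * of_rat p - 2 - of_int n) (Y u (n + 1) w)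
           + Y (L 1 u) n w"
    using c[of 2 n w]
    by (simp add: Vir_def Lm L0 mode_linear scale_left_distrib scale_left_diff_distrib
        numeral_2_eq_2 algebra_simps)
qed

lemma mode_weight:
  assumes p: "p \<in> half_ints" "u \<in> V p" and q: "q \<in> half_ints" "v \<in> V q"
    and r: "r = p + q - of_int n - 1"
  shows "Y u n v \<in> V r"
proof -
  have r': "r \<in> half_ints" unfolding r using p q by simp
  have "L 0 v = scale (of_rat q) v" using q weight_space[of q] by auto
  then have "L 0 (Y u n v) = scale (of_rat r) (Y u n v)"
    using L_commutator(2)[OF p, of n v]
    by (simp add: r mode_linear of_rat_add of_rat_diff scale_left_distrib scale_left_diff_distrib)
  then show ?thesis using weight_space[OF r'] by simp
qed

lemma vac_weight: "vac \<in> V 0"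
  using vac_annihilated[of 1 \<omega>] weight_space[of 0] by (simp add: Vir_def)

text \<open>
  Since \<open>\<omega> = L(-2)\<one>\<close> and \<open>L(0)\<one> = 0\<close>, the bracket \<open>[L(0), L(-2)] = 2 L(-2)\<close> gives the weight.
\<close>

lemma conformal_weight: "\<omega> \<in> V 2"
proof -
  have \<omega>: "\<omega> = L (-2) vac" by (simp add: Vir_def creation)
  have "L 0 vac = 0" by (simp add: Vir_def vac_annihilated)
  moreover obtain c where "\<forall>m n v. L m (L n v) - L n (L m v)
          = scale (of_int (m - n)) (L (m + n) v)
            + scale (if m + n = 0 then (of_int m ^ 3 - of_int m) / 12 * c else 0) v"
    using virasoro by blast
  from spec[OF spec[OF spec[OF this, of 0], of "-2"], of vac]
  have "L 0 (L (-2) vac) - L (-2) (L 0 vac) = scale 2 (L (-2) vac)" by simp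
  ultimately have "L 0 \<omega> = scale 2 \<omega>" by (simp flip: \<omega>)
  then show ?thesis using weight_space[of 2] by simp
qed

lemma L_weight:
  assumes "q \<in> half_ints" "v \<in> V q" and "r = q - of_int n"
  shows "L n v \<in> V r"
  unfolding Vir_def using assms conformal_weight by (intro mode_weight[of 2 _ q]) auto

lemma L1_L_minus1: "L 1 (L (-1) v) = L (-1) (L 1 v) + scale 2 (L 0 v)"
proof -
  obtain c where "\<forall>m n v. L m (L n v) - L n (L m v)
          = scale (of_int (m - n)) (L (m + n) v)
            + scale (if m + n = 0 then (of_int m ^ 3 - of_int m) / 12 * c else 0) v"
    using virasoro by blast
  from spec[OF spec[OF spec[OF this, of 1], of "-1"], of v] show ?thesis
    by (simp add: algebra_simps)
qed

lemma descendant_of_vac: "Y v (-2) vac = L (-1) v"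
  using derivative[of v "-1" vac] by (simp add: creation)

section \<open>Skew symmetry and generated ideals\<close>

text \<open>
  The vector \<open>w\<^sub>-\<^sub>1\<^sub>-\<^sub>i\<one>\<close> is \<open>L(-1)\<^sup>iw / i!\<close>, by repeated use of the derivative property.
\<close>

lemma creation_mode_in_stable_subspace:
  assumes S: "subspace S" and L: "\<And>x. x \<in> S \<Longrightarrow> L (-1) x \<in> S"
  shows "w \<in> S \<Longrightarrow> Y w (- 1 - int i) vac \<in> S"
proof (induction i arbitrary: w)
  case 0
  then show ?case by (simp add: creation)
next
  case (Suc i)
  have "Y (L (-1) w) (- 1 - int i) vac = scale (1 + of_nat i) (Y w (- 1 - int (Suc i)) vac)"
    using derivative[of w "- 1 - int i" vac] by (simp add: algebra_simps)
  then have "Y w (- 1 - int (Suc i)) vac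
      = scale (1 / (1 + of_nat i)) (Y (L (-1) w) (- 1 - int i) vac)"
    using of_nat_neq_0[of i, where 'a = complex] by simp
  then show ?case
    using Suc.IH[OF L[OF Suc.prems]] S by (simp add: subspace_scale)
qed

text \<open>
  Skew symmetry \<open>Y(v,z)u = \<plusminus> e\<^bsup>zL(-1)\<^esup> Y(u,-z)v\<close>, with \<open>L(-1)\<^sup>i / i!\<close> written as the mode
  \<open>-1-i\<close> applied to the vacuum. It is the Jacobi identity at \<open>k = -1\<close>, \<open>n = 0\<close> on the vacuum: all
  terms on the left-hand side contain a nonnegative mode applied to the vacuum, except the one with
  \<open>u\<^sub>-\<^sub>1\<one> = u\<close>.
\<close>

lemma skew_symmetry:
  assumes "u \<in> P \<alpha>" "v \<in> P \<beta>"
  shows "Y v m u = scale (- super_sign \<alpha> \<beta> * (- 1) powi m)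
    (Sum_any (\<lambda>i. scale ((- 1) ^ i) (Y (Y u (m + int i) v) (- 1 - int i) vac)))"
proof -
  let ?s = "super_sign \<alpha> \<beta> * (- 1) powi m"
  have choose: "complex_of_int (- 1) gchoose i = (- 1) ^ i" for i
    using gbinomial_minus[of "1::complex" i] by (simp add: binomial_gbinomial[symmetric])
  have "Sum_any (\<lambda>i::nat. scale ((- 1) ^ i * (of_int m gchoose i))
            (Y u (m + - 1 - int i) (Y v (0 + int i) vac)
             - scale ?s (Y v (m + 0 - int i) (Y u (- 1 + int i) vac))))
     = Sum_any (\<lambda>i::nat. if i = 0 then - scale ?s (Y v m u) else 0)"
    by (rule Sum_any.cong) (auto simp: vac_annihilated creation)
  then have "- scale ?s (Y v m u) =
      Sum_any (\<lambda>i. scale (of_int (- 1) gchoose i) (Y (Y u (m + int i) v) (0 + - 1 - int i) vac))"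
    using jacobi[OF assms, where m = m and n = 0 and k = "- 1" and w = vac]
    by (simp only: Sum_any.delta)
  then have *: "- scale ?s (Y v m u) =
      Sum_any (\<lambda>i. scale ((- 1) ^ i) (Y (Y u (m + int i) v) (- 1 - int i) vac))"
    unfolding choose by simp
  have "?s * ?s = 1"
    by (cases "even m") (auto simp: super_sign_def power_int_minus_left)
  then have "Y v m u = scale (- ?s) (- scale ?s (Y v m u))"
    by simp
  then show ?thesis unfolding * by simp
qed

lemma skew_symmetry_in_stable_subspace:
  assumes uv: "u \<in> P \<alpha>" "v \<in> P \<beta>"
    and S: "subspace S" and L: "\<And>x. x \<in> S \<Longrightarrow> L (-1) x \<in> S"
    and mem: "\<And>i. Y u (m + int i) v \<in> S"
  shows "Y v m u \<in> S"
  unfolding skew_symmetry[OF uv]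
  by (intro subspace_scale Sum_any_in_subspace creation_mode_in_stable_subspace S L mem)

lemma skew_symmetry_leading_term:
  assumes uv: "u \<in> P \<alpha>" "v \<in> P \<beta>"
    and L: "\<And>i. L (-1) (Y u (m + 1 + int i) v) = 0"
  shows "Y v m u = scale (- super_sign \<alpha> \<beta> * (- 1) powi m) (Y u m v)"
proof -
  have "Y (Y u (m + int (Suc i)) v) (- 1 - int (Suc i)) vac = 0" for i
  proof -
    have "scale (1 + of_nat i) (Y (Y u (m + int (Suc i)) v) (- 1 - int (Suc i)) vac) = 0"
      using derivative[of "Y u (m + 1 + int i) v" "- 1 - int i" vac] L[of i]
      by (simp add: algebra_simps)
    then show ?thesis
      using of_nat_neq_0[of i, where 'a = complex] by simp
  qed
  then have "scale ((- 1) ^ i) (Y (Y u (m + int i) v) (- 1 - int i) vac)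
      = (if i = 0 then Y u m v else 0)" for i
    by (cases i) (simp_all add: creation)
  then show ?thesis
    unfolding skew_symmetry[OF uv] by simp
qed

text \<open>
  A weak form of associativity, which makes the vectors \<open>x\<^sub>kw\<close> span the submodule generated by \<open>w\<close>.
  Choose \<open>k\<close> so large that \<open>u\<^sub>jw = 0\<close> for \<open>j \<ge> k\<close>. Then the Jacobi identity with first index
  \<open>m - k\<close> has no terms with \<open>u\<close> acting first, its right-hand side lies in the span, and on the left
  \<open>u\<^sub>mv\<^sub>nw\<close> is followed by terms with \<open>v\<^sub>n\<^sub>+\<^sub>iw\<close>, \<open>i > 0\<close>. Truncation allows downward induction
  on \<open>n\<close>.
\<close>

lemma composite_mode_in_span:
  "Y u m (Y v n w) \<in> span {Y x k w | x k. True}" (is "_ \<in> ?J")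
proof -
  have homogeneous: "Y u m (Y v n w) \<in> ?J" if uv: "u \<in> P \<alpha>" "v \<in> P \<beta>" for u v \<alpha> \<beta> m n
  proof -
    obtain k where k: "\<And>j. j \<ge> k \<Longrightarrow> Y u j w = 0" using truncation by blast
    obtain N where N: "\<And>j. j \<ge> N \<Longrightarrow> Y v j w = 0" using truncation by blast
    \<comment> \<open>The index \<open>m\<close> is quantified because the induction shifts it together with \<open>n\<close>.\<close>
    have "\<forall>m. Y u m (Y v n w) \<in> ?J" if "nat (N - n) = t" for n t
      using that
    proof (induction t arbitrary: n rule: less_induct)
      case (less t)
      show ?case
      proof (intro allI)
        fix m
        show "Y u m (Y v n w) \<in> ?J"
        proof (cases "n \<ge> N")
          case True
          then show ?thesis using N by (simp add: span_zero)
        next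
          case False
          let ?c = "\<lambda>i. (- 1) ^ i * (of_int (m - k) gchoose i) :: complex"
          let ?f = "\<lambda>i::nat. scale (?c i) (Y u (m - int i) (Y v (n + int i) w))"
          have "Sum_any ?f = Sum_any (\<lambda>i::nat. scale (?c i)
              (Y u (m - k + k - int i) (Y v (n + int i) w)
               - scale (super_sign \<alpha> \<beta> * (- 1) powi (m - k))
                   (Y v (m - k + n - int i) (Y u (k + int i) w))))"
            by (rule Sum_any.cong) (simp add: k)
          also have "\<dots> \<in> ?J"
            unfolding jacobi[OF uv]
            by (intro Sum_any_in_subspace subspace_span span_scale span_base) blast
          finally have J: "Sum_any ?f \<in> ?J" .
          let ?M = "nat (N - n)"
          have "?f i = 0" if "i \<notin> {..?M}" for i
          proof -
            have "n + int i \<ge> N" using that by auto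
            then show ?thesis by (simp add: N)
          qed
          then have "Sum_any ?f = sum ?f {..?M}"
            by (intro Sum_any.expand_superset) blast+
          also have "\<dots> = ?f 0 + sum ?f {1..?M}"
            by (simp add: atMost_atLeast0 sum.atLeast_Suc_atMost)
          finally have "Y u m (Y v n w) = Sum_any ?f - sum ?f {1..?M}" by simp
          moreover have "sum ?f {1..?M} \<in> ?J"
          proof (intro span_sum span_scale)
            fix i assume i: "i \<in> {1..?M}"
            then have "nat (N - (n + int i)) < t" using False less.prems by auto
            from less.IH[OF this refl] show "Y u (m - int i) (Y v (n + int i) w) \<in> ?J" by blast
          qed
          ultimately show ?thesis using J by (simp add: span_diff)
        qed
      qed
    qed
    then show ?thesis by blast
  qed
  have homogeneous_left: "v \<in> {v. Y v n w \<in> {x. Y u m x \<in> ?J}}" if u: "u \<in> P \<alpha>" for u \<alpha>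
    by (rule subspace_contains_by_parity)
      (use homogeneous[OF u] in \<open>blast intro: subspace_mode_preimage_left
        subspace_mode_preimage_right subspace_span\<close>)+
  have "u \<in> {u. Y u m (Y v n w) \<in> ?J}"
    by (rule subspace_contains_by_parity)
      (use homogeneous_left in \<open>blast intro: subspace_mode_preimage_left subspace_span\<close>)+
  then show ?thesis by blast
qed

text \<open>
  Closure under left multiplication is weak associativity; in particular the span is stable under
  \<open>L(-1) = \<omega>\<^sub>0\<close>, so skew symmetry turns right products into left products. Skew symmetry needs
  vectors of definite parity, which is where the homogeneity of \<open>c\<close> enters.
\<close>

lemma ideal_generated_by_homogeneous:
  assumes c: "c \<in> P \<gamma>"
  shows "vosa_ideal scale Y (span {Y u n c | u n. True})" (is "vosa_ideal _ _ ?J")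
proof -
  have left: "Y v n x \<in> ?J" if "x \<in> ?J" for v n x
  proof -
    have "?J \<subseteq> {x. Y v n x \<in> ?J}"
      by (intro span_minimal subspace_mode_preimage_right subspace_span)
        (use composite_mode_in_span in blast)
    then show ?thesis using that by auto
  qed
  have right_gen: "Y (Y u k c) n v \<in> ?J" if "u \<in> P \<alpha>" "v \<in> P \<beta>" for u v \<alpha> \<beta> n k
  proof (rule skew_symmetry_in_stable_subspace)
    show "v \<in> P \<beta>" "Y u k c \<in> P (\<alpha> + \<gamma>)" using that c Y_parity by auto
    show "Y v (n + int i) (Y u k c) \<in> ?J" for i by (intro left span_base) blast
    show "L (-1) x \<in> ?J" if "x \<in> ?J" for x
      unfolding Vir_def by (rule left[OF that])
  qed (rule subspace_span)
  have right_parity: "v \<in> {v. Y (Y u k c) n v \<in> ?J}" if u: "u \<in> P \<alpha>" for u \<alpha> v n k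
    by (rule subspace_contains_by_parity)
      (use right_gen[OF u] in \<open>blast intro: subspace_mode_preimage_right subspace_span\<close>)+
  have right: "u \<in> {u. Y u k c \<in> {x. Y x n v \<in> ?J}}" for u k n v
    by (rule subspace_contains_by_parity)
      (use right_parity in \<open>blast intro: subspace_mode_preimage_left subspace_span\<close>)+
  have "?J \<subseteq> {x. Y x n v \<in> ?J}" for v n
    by (intro span_minimal subspace_mode_preimage_left subspace_span) (use right in blast)
  then show ?thesis
    unfolding vosa_ideal_def using left by blast
qed

text \<open>
  Membership in this subspace \<open>K\<close> expresses that the component of weight \<open>0\<close> vanishes. It plays the
  part of orthogonality for the invariant form: \<open>u\<^sub>nv \<in> K\<close> says that a matrix coefficient is \<open>0\<close>.
\<close>

definition nonvacuum_part :: "'v set" where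
  "nonvacuum_part = span (\<Union>q\<in>half_ints - {0}. V q)"

lemma subspace_nonvacuum_part: "subspace nonvacuum_part"
  unfolding nonvacuum_part_def by simp

lemma nonzero_weight_in_nonvacuum_part:
  "q \<in> half_ints \<Longrightarrow> q \<noteq> 0 \<Longrightarrow> v \<in> V q \<Longrightarrow> v \<in> nonvacuum_part"
  unfolding nonvacuum_part_def by (intro span_base) blast

lemma vac_notin_nonvacuum_part:
  assumes "vac \<noteq> 0"
  shows "vac \<notin> nonvacuum_part"
  using weight_space_independent[OF half_ints_0 vac_weight] assms unfolding nonvacuum_part_def by blast

end

section \<open>Simple algebras generated in weights 3/2 and 2\<close>

locale simple_vosa_low_generated = vertex_operator_superalgebra +
  assumes simple: "vosa_simple scale Y"
    and generated: "strongly_generates scale Y vac {x + y | x y. x \<in> V (3/2) \<and> y \<in> V 2}"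
begin

definition low_generators :: "rat \<Rightarrow> 'a set" where
  "low_generators q =
     (if q = 0 then {vac}
      else if q = 3/2 \<or> q = 2 \<or> q \<ge> 7/2 then V q
      else if q = 5/2 then L (-1) ` V (3/2)
      else if q = 3 then L (-1) ` V 2 \<union> {Y x (-1) y | x y. x \<in> V (3/2) \<and> y \<in> V (3/2)}
      else {})"

lemma low_generators_subset:
  "low_generators q \<subseteq> V q"
proof -
  have "L (-1) x \<in> V (5/2)" if "x \<in> V (3/2)" for x
    using that by (intro L_weight[of "3/2"]) auto
  moreover have "L (-1) x \<in> V 3" if "x \<in> V 2" for x
    using that by (intro L_weight[of 2]) auto
  moreover have "Y x (-1) y \<in> V 3" if "x \<in> V (3/2)" "y \<in> V (3/2)" for x y
    using that by (intro mode_weight[of "3/2" _ "3/2"]) auto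
  ultimately show ?thesis
    using vac_weight unfolding low_generators_def by (auto simp del: eq_divide_eq_numeral1)
qed

text \<open>
  The span contains the vacuum and is stable under \<open>t\<^sub>-\<^sub>n\<close> for every generator \<open>t\<close> and \<open>n > 0\<close>. The
  operator \<open>t\<^sub>-\<^sub>n\<close> raises the weight by at least \<open>3/2\<close> or \<open>2\<close> according to the weight of \<open>t\<close>, so
  the result has weight at least \<open>7/2\<close> except in five cases: \<open>t\<^sub>-\<^sub>1\<one> = t\<close> and \<open>t\<^sub>-\<^sub>2\<one> = L(-1)t\<close> for
  either weight of \<open>t\<close>, and \<open>x\<^sub>-\<^sub>1y\<close> for \<open>x\<close>, \<open>y\<close> of weight \<open>3/2\<close>.
\<close>

lemma span_low_generators: "span (\<Union>q\<in>half_ints. low_generators q) = UNIV" (is "?S = UNIV")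
proof -
  have base: "g \<in> ?S" if "q \<in> half_ints" "g \<in> low_generators q" for q g
    using that by (intro span_base) blast
  have high: "g \<in> ?S" if "q \<in> half_ints" "q \<ge> 7/2" "g \<in> V q" for q g
    using that by (intro base[of q]) (auto simp: low_generators_def)
  have odd_step: "Y x (- n) g \<in> ?S"
    if x: "x \<in> V (3/2)" and n: "n > 0" and q: "q \<in> half_ints" "g \<in> low_generators q" for x n q g
  proof -
    have w: "Y x (- n) g \<in> V (q + of_int n + 1/2)"
      using x q low_generators_subset[of q] by (intro mode_weight[of "3/2" _ q]) auto
    have cases: "q = 0 \<and> n = 1 \<or> q = 0 \<and> n = 2 \<or> q = 3/2 \<and> n = 1 \<or> q + of_int n + 1/2 \<ge> 7/2"
    proof -
      have "q = 0 \<or> q = 3/2 \<or> q \<ge> 2"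
        using q by (auto simp: low_generators_def split: if_splits)
      moreover have "n = 1 \<or> n = 2 \<or> n \<ge> 3" using n by auto
      then have "n = 1 \<or> n = 2 \<or> (of_int n :: rat) \<ge> 3" by linarith
      moreover have "(of_int n :: rat) \<ge> 1" using n by simp
      ultimately show ?thesis by auto
    qed
    consider "q = 0" "n = 1" | "q = 0" "n = 2" | "q = 3/2" "n = 1" | "q + of_int n + 1/2 \<ge> 7/2"
      using cases by blast
    then show ?thesis
    proof cases
      case 1
      then show ?thesis using x q by (intro base[of "3/2"]) (auto simp: low_generators_def creation)
    next
      case 2
      then show ?thesis
        using x q by (intro base[of "5/2"]) (auto simp: low_generators_def descendant_of_vac)
    next
      case 3
      have "low_generators (3/2) = V (3/2)" by (simp add: low_generators_def)
      then have "g \<in> V (3/2)" using q(2) 3(1) by blast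
      then have "Y x (-1) g \<in> low_generators 3"
        unfolding low_generators_def using x by simp blast
      then show ?thesis using base[of 3] 3(2) by simp
    next
      case 4
      show ?thesis by (rule high[OF _ 4 w]) (use q in auto)
    qed
  qed
  have even_step: "Y x (- n) g \<in> ?S"
    if x: "x \<in> V 2" and n: "n > 0" and q: "q \<in> half_ints" "g \<in> low_generators q" for x n q g
  proof -
    have w: "Y x (- n) g \<in> V (q + of_int n + 1)"
      using x q low_generators_subset[of q] by (intro mode_weight[of 2 _ q]) auto
    have cases: "q = 0 \<and> n = 1 \<or> q = 0 \<and> n = 2 \<or> q + of_int n + 1 \<ge> 7/2"
    proof -
      have "q = 0 \<or> q \<ge> 3/2"
        using q by (auto simp: low_generators_def split: if_splits)
      moreover have "n = 1 \<or> n = 2 \<or> n \<ge> 3" using n by auto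
      then have "n = 1 \<or> n = 2 \<or> (of_int n :: rat) \<ge> 3" by linarith
      moreover have "(of_int n :: rat) \<ge> 1" using n by simp
      ultimately show ?thesis by auto
    qed
    consider "q = 0" "n = 1" | "q = 0" "n = 2" | "q + of_int n + 1 \<ge> 7/2"
      using cases by blast
    then show ?thesis
    proof cases
      case 1
      then show ?thesis using x q by (intro base[of 2]) (auto simp: low_generators_def creation)
    next
      case 2
      then show ?thesis
        using x q by (intro base[of 3]) (auto simp: low_generators_def descendant_of_vac)
    next
      case 3
      show ?thesis by (rule high[OF _ 3 w]) (use q in auto)
    qed
  qed
  have step: "Y (x + y) (- n) v \<in> ?S"
    if "x \<in> V (3/2)" "y \<in> V 2" "n > 0" "v \<in> ?S" for x y n v
  proof -
    have "?S \<subseteq> {v. Y (x + y) (- n) v \<in> ?S}"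
      by (intro span_minimal subspace_mode_preimage_right subspace_span)
        (use that odd_step even_step in \<open>auto simp: mode_add_left intro!: span_add\<close>)
    then show ?thesis using that by auto
  qed
  have vac: "vac \<in> ?S" by (rule base[of 0]) (auto simp: low_generators_def)
  have "foldr (\<lambda>(a, n). Y a (- n)) xs vac \<in> ?S"
    if "set xs \<subseteq> {x + y | x y. x \<in> V (3/2) \<and> y \<in> V 2} \<times> {n::int. n > 0}" for xs
    using that by (induction xs) (auto intro: vac step)
  then have "insert vac {foldr (\<lambda>(a, n). Y a (- n)) xs vac | xs. xs \<noteq> [] \<and>
      set xs \<subseteq> {x + y | x y. x \<in> V (3/2) \<and> y \<in> V 2} \<times> {n::int. n > 0}} \<subseteq> ?S"
    using vac by blast
  from span_minimal[OF this subspace_span] show ?thesis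
    using generated unfolding strongly_generates_def by blast
qed

lemma weight_space_low_generators: "q \<in> half_ints \<Longrightarrow> V q = span (low_generators q)"
  using low_generators_subset span_low_generators by (intro weight_space_generated)

lemma weight_gap:
  assumes "q \<in> half_ints" "q < 3/2" "q \<noteq> 0" "v \<in> V q"
  shows "v = 0"
  using weight_space_low_generators[OF assms(1)] assms by (auto simp: low_generators_def)

text \<open>
  Every vector of weight \<open>5/2\<close> is \<open>L(-1)z\<close> with \<open>z\<close> of weight \<open>3/2\<close>, and
  \<open>L(1)L(-1)z = 2 L(0)z = 3z\<close>. Hence \<open>L(1)\<close> is injective on this weight space.
\<close>

lemma weight_52_descendant:
  assumes "v \<in> V (5/2)"
  shows "v = scale (1/3) (L (-1) (L 1 v))"
proof -
  have "v \<in> span (L (-1) ` V (3/2))"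
    using assms weight_space_low_generators[of "5/2"] by (simp add: low_generators_def)
  moreover have "L (-1) z = scale (1/3) (L (-1) (L 1 (L (-1) z)))" if z: "z \<in> V (3/2)" for z
  proof -
    have "L 1 z \<in> V (1/2)" using z by (intro L_weight[of "3/2"]) auto
    then have "L 1 z = 0" by (intro weight_gap[of "1/2"]) auto
    moreover have "L 0 z = scale (3/2) z" using z weight_space[of "3/2"] by (auto simp: of_rat_divide)
    ultimately show ?thesis by (simp add: L1_L_minus1 L_scale)
  qed
  moreover have "subspace {v. v = scale (1/3) (L (-1) (L 1 v))}"
    by (auto simp: subspace_def Vir_def mode_linear scale_right_distrib scale_left_commute
        simp del: scale_scale)
  ultimately show ?thesis
    using span_induct[of v _ "\<lambda>v. v = scale (1/3) (L (-1) (L 1 v))"] by auto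
qed

section \<open>Orthogonality of quasi-primary vectors\<close>

lemma L1_vanishes:
  assumes "q \<in> half_ints" "q < 5/2" "q \<noteq> 1" "v \<in> V q"
  shows "L 1 v = 0"
  using assms by (intro weight_gap[of "q - 1"] L_weight[of q]) auto

text \<open>
  Below weight \<open>3/2\<close> only weight \<open>0\<close> is left, and \<open>L(-1)\<close> maps it into \<open>V\<^sub>(\<^sub>1\<^sub>) = 0\<close>.
\<close>

lemma L_minus1_vanishes:
  assumes "q \<in> half_ints" "q < 3/2" "v \<in> V q"
  shows "L (-1) v = 0"
proof (cases "q = 0")
  case True
  then show ?thesis using assms by (intro weight_gap[of 1] L_weight[of q]) auto
next
  case False
  then show ?thesis using weight_gap[OF assms(1,2) False assms(3)] by simp
qed

text \<open>
  A mode of a homogeneous vector shifts weights by a fixed amount, so it can reach weight \<open>0\<close> from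
  one weight only. If that weight space vanishes, the whole image lies in the non-vacuum part.
\<close>

lemma mode_in_nonvacuum_part:
  assumes x: "p \<in> half_ints" "x \<in> V p"
    and source: "of_int n + 1 - p < 3/2" "of_int n + 1 \<noteq> p"
  shows "Y x n v \<in> nonvacuum_part"
proof -
  have "v \<in> {v. Y x n v \<in> nonvacuum_part}"
  proof (rule subspace_contains_by_weight)
    show "v \<in> {v. Y x n v \<in> nonvacuum_part}" if v: "q \<in> half_ints" "v \<in> V q" for q v
    proof (cases "p + q - of_int n - 1 = 0")
      case True
      then have "v = 0" using source by (intro weight_gap[OF v(1) _ _ v(2)]) auto
      then show ?thesis using subspace_nonvacuum_part by (simp add: subspace_0)
    next
      case False
      have "Y x n v \<in> V (p + q - of_int n - 1)" using v x by (intro mode_weight[of p _ q]) auto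
      then show ?thesis
        using nonzero_weight_in_nonvacuum_part[OF _ False] v x by simp
    qed
  qed (rule subspace_mode_preimage_right[OF subspace_nonvacuum_part])
  then show ?thesis by simp
qed

lemma L_minus1_in_nonvacuum_part: "L (-1) v \<in> nonvacuum_part"
  unfolding Vir_def using conformal_weight by (intro mode_in_nonvacuum_part[of 2]) auto

lemma L1_in_nonvacuum_part: "L 1 v \<in> nonvacuum_part"
  unfolding Vir_def using conformal_weight by (intro mode_in_nonvacuum_part[of 2]) auto

lemma odd_creation_in_nonvacuum_part: "x \<in> V (3/2) \<Longrightarrow> Y x (-1) v \<in> nonvacuum_part"
  by (intro mode_in_nonvacuum_part[of "3/2"]) auto

text \<open>
  By weights, only \<open>n = h + h' - 1\<close> is at stake. For this \<open>n\<close>, the commutator of \<open>L(1)\<close> with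
  \<open>p\<^sub>n\<^sub>-\<^sub>1\<close> is \<open>(h - h') p\<^sub>n\<close>, so \<open>(h - h') p\<^sub>nq = L(1) p\<^sub>n\<^sub>-\<^sub>1q - p\<^sub>n\<^sub>-\<^sub>1 L(1)q\<close>, where both terms
  on the right lie in \<open>K\<close>. The hypothesis on \<open>L(1)q\<close> holds trivially for quasi-primary \<open>q\<close>; the
  general form supports induction on the weight of \<open>q\<close>.
\<close>

lemma quasi_primary_orthogonality:
  assumes p: "h \<in> half_ints" "p \<in> V h" and Lp: "L 1 p = 0"
    and q: "h' \<in> half_ints" "q \<in> V h'" and Lq: "\<And>n. Y p n (L 1 q) \<in> nonvacuum_part"
    and "h \<noteq> h'"
  shows "Y p n q \<in> nonvacuum_part"
proof (cases "h + h' - of_int n - 1 = 0")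
  case False
  have "Y p n q \<in> V (h + h' - of_int n - 1)" using p q by (intro mode_weight[of h _ h']) auto
  then show ?thesis using False p q by (intro nonzero_weight_in_nonvacuum_part) auto
next
  case True
  then have n: "of_int n = h + h' - 1" by simp
  have "2 * of_rat h - 2 - of_int (n - 1) = (of_rat (2 * h - 1 - of_int n) :: complex)"
    by (simp add: of_rat_diff of_rat_mult)
  also have "\<dots> = of_rat (h - h')" by (simp add: n)
  finally have "scale (of_rat (h - h')) (Y p n q) = L 1 (Y p (n - 1) q) - Y p (n - 1) (L 1 q)"
    using L_commutator(3)[OF p, of "n - 1" q] Lp by simp
  also have "\<dots> \<in> nonvacuum_part"
    by (intro subspace_diff subspace_nonvacuum_part L1_in_nonvacuum_part Lq)
  finally have "scale (inverse (of_rat (h - h'))) (scale (of_rat (h - h')) (Y p n q)) \<in> nonvacuum_part"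
    by (rule subspace_scale[OF subspace_nonvacuum_part])
  moreover have "(of_rat (h - h') :: complex) \<noteq> 0" using \<open>h \<noteq> h'\<close> by simp
  ultimately show ?thesis by simp
qed

lemma weight_2_even: "V 2 \<subseteq> P 0" and weight_3_even: "V 3 \<subseteq> P 0"
  and weight_32_odd: "V (3/2) \<subseteq> P 1"
  using even_weight[of 2] even_weight[of 3] odd_weight[of 1] by simp_all

text \<open>
  The correction terms of skew symmetry are descendants of \<open>u\<^sub>m\<^sub>+\<^sub>1\<^sub>+\<^sub>iv\<close>, which have weight at most
  \<open>p + q - m - 2 < 3/2\<close> and are therefore killed by \<open>L(-1)\<close>.
\<close>

lemma skew_symmetry_low:
  assumes p: "p \<in> half_ints" "u \<in> V p" "u \<in> P 0" and q: "q \<in> half_ints" "v \<in> V q"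
    and m: "p + q - of_int m < 7/2"
  shows "Y v m u = scale (- ((- 1) powi m)) (Y u m v)"
proof -
  obtain \<beta> where v: "v \<in> P \<beta>" using weight_parity q by (metis subsetD)
  have "L (-1) (Y u (m + 1 + int i) v) = 0" for i
  proof (rule L_minus1_vanishes)
    show "Y u (m + 1 + int i) v \<in> V (p + q - of_int (m + 1 + int i) - 1)"
      using p q by (intro mode_weight[of p _ q]) auto
    have "(0::rat) \<le> of_nat i" by simp
    then show "p + q - of_int (m + 1 + int i) - 1 < 3/2" using m by simp
    show "p + q - of_int (m + 1 + int i) - 1 \<in> half_ints"
      by (intro half_ints_diff half_ints_add p q half_ints_of_int half_ints_1)
  qed
  then show ?thesis
    using skew_symmetry_leading_term[OF p(3) v] by simp
qed

section \<open>Vanishing of the obstruction\<close>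

definition obstruction :: "'a \<Rightarrow> 'a \<Rightarrow> 'a" where
  "obstruction a b = Y a 0 b - scale (1/2) (L (-1) (Y a 1 b))"

context
  fixes a b
  assumes a: "a \<in> V 2" and b: "b \<in> V 2"
begin

lemma product_1_weight: "Y a 1 b \<in> V 2"
  using a b by (intro mode_weight[of 2 _ 2]) auto

lemma obstruction_weight: "obstruction a b \<in> V 3"
proof -
  have "Y a 0 b \<in> V 3" using a b by (intro mode_weight[of 2 _ 2]) auto
  moreover have "L (-1) (Y a 1 b) \<in> V 3" using product_1_weight by (intro L_weight[of 2]) auto
  ultimately show ?thesis
    unfolding obstruction_def by (intro subspace_diff subspace_scale weight_subspace) auto
qed

text \<open>
  The factor \<open>1/2\<close> is chosen for this: \<open>L(1) a\<^sub>0b = 2 a\<^sub>1b\<close>, while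
  \<open>L(1)L(-1) a\<^sub>1b = 2 L(0) a\<^sub>1b = 4 a\<^sub>1b\<close>.
\<close>

lemma L1_obstruction: "L 1 (obstruction a b) = 0"
proof -
  have zero: "L 1 v = 0" if "v \<in> V 2" for v
    using that by (intro L1_vanishes[of 2]) auto
  have "L 0 (Y a 1 b) = scale 2 (Y a 1 b)"
    using product_1_weight weight_space[of 2] by auto
  then have "L 1 (L (-1) (Y a 1 b)) = scale 4 (Y a 1 b)"
    by (simp add: L1_L_minus1 zero[OF product_1_weight])
  moreover have "L 1 (Y a 0 b) = scale 2 (Y a 1 b)"
    using L_commutator(3)[of 2 a 0 b] a by (simp add: zero[OF a] zero[OF b])
  ultimately show ?thesis
    by (simp add: obstruction_def Vir_def mode_linear)
qed

end

lemma symmetric_product_1: "a \<in> V 2 \<Longrightarrow> b \<in> V 2 \<Longrightarrow> Y b 1 a = Y a 1 b"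
  using skew_symmetry_low[of 2 a 2 b 1] weight_2_even by auto

lemma odd_even_product_1: "a \<in> V 2 \<Longrightarrow> x \<in> V (3/2) \<Longrightarrow> Y x 1 a = Y a 1 x"
  using skew_symmetry_low[of 2 a "3/2" x 1] weight_2_even by auto

text \<open>
  Put \<open>z = a\<^sub>1x = x\<^sub>1a\<close>. Since \<open>L(1) x\<^sub>0a = x\<^sub>1a = z\<close>, the vector \<open>x\<^sub>0a\<close> of weight \<open>5/2\<close> is
  \<open>(1/3) L(-1)z\<close>. So \<open>[x\<^sub>2, a\<^sub>0] = (x\<^sub>0a)\<^sub>2 + 2 (x\<^sub>1a)\<^sub>1 = (4/3) z\<^sub>1\<close>, which gives the first term.
  The second one comes from \<open>[x\<^sub>2, L(-1)] = 2 x\<^sub>1\<close>. All terms with \<open>x\<^sub>2\<close> applied to a vector of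
  weight \<open>2\<close> lie in \<open>V\<^sub>(\<^sub>1\<^sub>/\<^sub>2\<^sub>) = 0\<close>.
\<close>

lemma odd_mode_2_obstruction:
  assumes a: "a \<in> V 2" and b: "b \<in> V 2" and x: "x \<in> V (3/2)"
  shows "Y x 2 (obstruction a b) = scale (4/3) (Y b 1 (Y a 1 x)) - Y (Y a 1 b) 1 x"
proof -
  let ?z = "Y a 1 x"
  have z: "?z \<in> V (3/2)" using a x by (intro mode_weight[of 2 _ "3/2"]) auto
  have vanish: "Y x 2 v = 0" if "v \<in> V 2" for v
    using that x by (intro weight_gap[of "1/2"] mode_weight[of "3/2" _ 2]) auto
  have "Y x 0 a \<in> V (5/2)" using a x by (intro mode_weight[of "3/2" _ 2]) auto
  moreover have "L 1 (Y x 0 a) = Y x 1 a"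
    using L_commutator(3)[of "3/2" x 0 a] x L1_vanishes[of 2 a] L1_vanishes[of "3/2" x] a
    by (simp add: of_rat_divide)
  ultimately have "Y x 0 a = scale (1/3) (L (-1) ?z)"
    using weight_52_descendant odd_even_product_1[OF a x] by metis
  then have "Y (Y x 0 a) 2 b = scale (- 2/3) (Y ?z 1 b)"
    using derivative[of ?z 2 b] by (simp add: mode_linear)
  moreover have "Y x 2 (Y a 0 b) = Y a 0 (Y x 2 b) + Y (Y x 0 a) 2 b + scale 2 (Y (Y x 1 a) 1 b)
      + Y (Y x 2 a) 0 b"
    using super_commutator_nonneg[of x 1 a 0 2 0 b] x a weight_32_odd weight_2_even
    by (auto simp: numeral_2_eq_2 add.assoc)
  ultimately have "Y x 2 (Y a 0 b) = scale (- 2/3) (Y ?z 1 b) + scale 2 (Y ?z 1 b)"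
    by (simp add: vanish a b odd_even_product_1 x)
  also have "\<dots> = scale (- 2/3 + 2) (Y ?z 1 b)"
    by (simp only: scale_left_distrib)
  also have "\<dots> = scale (4/3) (Y b 1 ?z)"
    by (simp add: odd_even_product_1[OF b z])
  finally have "Y x 2 (Y a 0 b) = scale (4/3) (Y b 1 ?z)" .
  moreover have "Y x 2 (L (-1) (Y a 1 b)) = scale 2 (Y (Y a 1 b) 1 x)"
    using L_commutator(1)[of "3/2" x 2 "Y a 1 b"] x product_1_weight[OF a b]
    by (simp add: vanish odd_even_product_1[OF _ x])
  ultimately show ?thesis
    by (simp add: obstruction_def mode_linear)
qed

text \<open>
  With \<open>A = b\<^sub>1a\<^sub>1x\<close>, \<open>B = a\<^sub>1b\<^sub>1x\<close> and \<open>E = (a\<^sub>1b)\<^sub>1x\<close>, the commutator formula gives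
  \<open>c\<^sub>2x = B - A\<close>, so by skew symmetry \<open>x\<^sub>2c = A - B\<close>, while the preceding lemma gives
  \<open>x\<^sub>2c = (4/3) A - E\<close>. Exchanging \<open>a\<close> and \<open>b\<close> exchanges \<open>A\<close> and \<open>B\<close> and fixes \<open>E\<close>, because
  \<open>a\<^sub>1b = b\<^sub>1a\<close>. Subtracting the two equations yields \<open>2 (A - B) = (4/3) (A - B)\<close>.
\<close>

lemma obstruction_mode_2_odd:
  assumes a: "a \<in> V 2" and b: "b \<in> V 2" and x: "x \<in> V (3/2)"
  shows "Y (obstruction a b) 2 x = 0"
proof -
  have comm: "Y (obstruction a b) 2 x = Y a 1 (Y b 1 x) - Y b 1 (Y a 1 x)"
    if "a \<in> V 2" "b \<in> V 2" for a b
  proof -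
    have "Y a 1 (Y b 1 x) = Y b 1 (Y a 1 x) + Y (Y a 0 b) 2 x + Y (Y a 1 b) 1 x"
      using super_commutator_nonneg[OF subsetD[OF weight_2_even that(1)]
          subsetD[OF weight_2_even that(2)], of 1 1 x] by (simp add: add.assoc)
    then show ?thesis
      by (simp add: obstruction_def mode_linear derivative)
  qed
  have skew: "Y x 2 (obstruction a b) = - Y (obstruction a b) 2 x" if "a \<in> V 2" "b \<in> V 2" for a b
    using skew_symmetry_low[OF _ obstruction_weight[OF that]
        subsetD[OF weight_3_even obstruction_weight[OF that]] _ x, of 2] by simp
  let ?A = "Y b 1 (Y a 1 x)" and ?B = "Y a 1 (Y b 1 x)" and ?E = "Y (Y a 1 b) 1 x"
  have "?A - ?B = scale (4/3) ?A - ?E"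
    using skew[OF a b] comm[OF a b] odd_mode_2_obstruction[OF a b x] by simp
  moreover have "?B - ?A = scale (4/3) ?B - ?E"
    using skew[OF b a] comm[OF b a] odd_mode_2_obstruction[OF b a x]
    by (simp add: symmetric_product_1[OF a b])
  ultimately have "(?A - ?B) - (?B - ?A) = scale (4/3) ?A - scale (4/3) ?B"
    by simp
  moreover have "(?A - ?B) - (?B - ?A) = scale 2 (?A - ?B)"
    using scale_left_distrib[of 1 1 "?A - ?B"] by (simp add: algebra_simps)
  ultimately have "scale 2 (?A - ?B) - scale (4/3) (?A - ?B) = 0"
    by (simp add: scale_right_diff_distrib)
  then have "scale (2/3) (?A - ?B) = 0"
    using scale_left_diff_distrib[of 2 "4/3" "?A - ?B"] by simp
  then show ?thesis using comm[OF a b] by simp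
qed

text \<open>
  Induction on the weight of \<open>u\<close>. Orthogonality of quasi-primary vectors reduces \<open>u\<close> to \<open>L(1)u\<close> when
  the weight is not \<open>3\<close>; in weight \<open>3\<close> the two kinds of spanning vectors are treated directly. For
  \<open>x\<^sub>-\<^sub>1y\<close> all \<open>c\<^sub>ix\<close> with \<open>i > 0\<close> vanish, so the commutator of \<open>c\<^sub>n\<close> and \<open>x\<^sub>-\<^sub>1\<close> is
  \<open>(c\<^sub>0x)\<^sub>n\<^sub>-\<^sub>1\<close>, and \<open>c\<^sub>0x\<close> is quasi-primary of weight \<open>7/2\<close>, different from the weight of \<open>y\<close>.
\<close>

lemma obstruction_modes_in_nonvacuum_part:
  assumes a: "a \<in> V 2" and b: "b \<in> V 2"
  shows "Y (obstruction a b) n u \<in> nonvacuum_part"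
proof -
  let ?c = "obstruction a b"
  note c = obstruction_weight[OF a b]
  note Lc = L1_obstruction[OF a b]
  note K = subspace_nonvacuum_part
  have orth: "Y ?c n u \<in> nonvacuum_part"
    if "q \<in> half_ints" "u \<in> V q" "q \<noteq> 3" "\<And>n. Y ?c n (L 1 u) \<in> nonvacuum_part" for q u n
    by (rule quasi_primary_orthogonality[OF _ c Lc that(1,2,4)]) (use that(3) in auto)
  have odd_product: "Y ?c n (Y x (-1) y) \<in> nonvacuum_part"
    if x: "x \<in> V (3/2)" and y: "y \<in> V (3/2)" for x y n
  proof -
    have Lx: "L 1 v = 0" if "v \<in> V (3/2)" for v
      using that by (intro L1_vanishes[of "3/2"]) auto
    \<comment> \<open>Thus \<open>L(1)\<close> maps \<open>c\<^sub>1x\<close> to a multiple of \<open>c\<^sub>2x = 0\<close>, and \<open>c\<^sub>0x\<close> to a multiple of \<open>c\<^sub>1x\<close>.\<close>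
    have L1: "L 1 (Y ?c m x) = scale (4 - of_int m) (Y ?c (m + 1) x)" for m
      using L_commutator(3)[OF _ c, of m x] by (simp add: Lc Lx[OF x])
    have c1: "Y ?c 1 x = 0"
    proof -
      have "Y ?c 1 x \<in> V (5/2)" using c x by (intro mode_weight[of 3 _ "3/2"]) auto
      moreover have "L 1 (Y ?c 1 x) = 0"
        using L1[of 1] obstruction_mode_2_odd[OF a b x] by simp
      ultimately show ?thesis using weight_52_descendant[of "Y ?c 1 x"] by simp
    qed
    have vanish: "Y ?c (int i) x = 0" if "i > 0" for i
    proof (cases "i \<le> 2")
      case True
      then have "i = 1 \<or> i = 2" using that by auto
      then show ?thesis using c1 obstruction_mode_2_odd[OF a b x] by auto
    next
      case False
      have "Y ?c (int i) x \<in> V (7/2 - of_nat i)"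
        using c x by (intro mode_weight[of 3 _ "3/2"]) auto
      moreover have "7/2 - of_nat i \<in> half_ints"
        using half_ints_diff[OF half_ints_half half_ints_of_int[of "int i"]] by simp
      moreover have "(of_nat i :: rat) \<ge> of_nat 3" using False by (simp only: of_nat_le_iff)
      moreover have "(7/2 :: rat) \<noteq> of_nat i"
      proof
        assume "(7/2 :: rat) = of_nat i"
        then have "(of_nat 7 :: rat) = of_nat (2 * i)" by simp
        then have "7 = 2 * i" by (simp only: of_nat_eq_iff)
        then show False by presburger
      qed
      ultimately show ?thesis by (intro weight_gap[of "7/2 - of_nat i"]) auto
    qed
    let ?d = "Y ?c 0 x"
    have d: "?d \<in> V (7/2)" using c x by (intro mode_weight[of 3 _ "3/2"]) auto
    have Ld: "L 1 ?d = 0" using L1[of 0] by (simp add: c1)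
    have d_y: "Y ?d m y \<in> nonvacuum_part" for m
      by (rule quasi_primary_orthogonality[OF _ d Ld _ y]) (auto simp: Lx[OF y] subspace_0[OF K])
    have c_even: "?c \<in> P 0" and x_odd: "x \<in> P 1"
      using c x weight_3_even weight_32_odd by auto
    have "Y ?c n (Y x (-1) y) = Y x (-1) (Y ?c n y) +
        Sum_any (\<lambda>i. scale (of_int n gchoose i) (Y (Y ?c (int i) x) (-1 + n - int i) y))"
      using super_commutator[OF c_even x_odd, of n "-1" y] by simp
    also have "(\<lambda>i. scale (of_int n gchoose i) (Y (Y ?c (int i) x) (-1 + n - int i) y))
        = (\<lambda>i. if i = 0 then Y ?d (n - 1) y else 0)"
      by (rule ext) (auto simp: vanish)
    finally show ?thesis
      using odd_creation_in_nonvacuum_part[OF x] d_y K by (simp add: subspace_add)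
  qed
  have derivative_product: "Y ?c n (L (-1) v) \<in> nonvacuum_part" if v: "v \<in> V 2" for v n
  proof -
    have "L 1 v = 0" using v by (intro L1_vanishes[of 2]) auto
    then have "Y ?c n v \<in> nonvacuum_part" for n
      using orth[of 2 v n] v K by (simp add: subspace_0)
    moreover have "Y ?c n (L (-1) v) = L (-1) (Y ?c n v) - scale (- of_int n) (Y ?c (n - 1) v)"
      using L_commutator(1)[OF _ c, of n v] by simp
    ultimately show ?thesis
      using L_minus1_in_nonvacuum_part K by (metis subspace_diff subspace_scale)
  qed
  have weight_3: "Y ?c n u \<in> nonvacuum_part" if "u \<in> V 3" for u n
  proof -
    have "V 3 \<subseteq> {u. Y ?c n u \<in> nonvacuum_part}"
      unfolding weight_space_low_generators[OF half_ints_numeral[of "num.Bit1 num.One"]]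
      by (intro span_minimal subspace_mode_preimage_right K)
        (use odd_product derivative_product in \<open>auto simp: low_generators_def\<close>)
    then show ?thesis using that by auto
  qed
  \<comment> \<open>Weights are half-integers, so the induction runs over a natural number that bounds them.\<close>
  have "Y ?c n u \<in> nonvacuum_part" if "q \<in> half_ints" "q < of_nat k" "u \<in> V q" for k q u n
    using that
  proof (induction k arbitrary: q u n)
    case 0
    then have "u = 0" using weight_gap[of q u] by simp
    then show ?case using K by (simp add: subspace_0)
  next
    case (Suc k)
    show ?case
    proof (cases "q = 3")
      case True
      then show ?thesis using weight_3 Suc.prems by simp
    next
      case False
      have "L 1 u \<in> V (q - 1)" using Suc.prems by (intro L_weight[of q]) auto
      then have "Y ?c n (L 1 u) \<in> nonvacuum_part" for n
        using Suc.prems by (intro Suc.IH[of "q - 1"]) auto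
      then show ?thesis by (rule orth[OF Suc.prems(1,3) False])
    qed
  qed
  then have homogeneous: "Y ?c n u \<in> nonvacuum_part" if "q \<in> half_ints" "u \<in> V q" for q u n
    using that reals_Archimedean2[of q] by blast
  have "u \<in> {u. Y ?c n u \<in> nonvacuum_part}"
    by (rule subspace_contains_by_weight[OF subspace_mode_preimage_right[OF K]])
      (use homogeneous in blast)
  then show ?thesis by simp
qed

lemma obstruction_zero:
  assumes a: "a \<in> V 2" and b: "b \<in> V 2"
  shows "obstruction a b = 0"
proof -
  let ?c = "obstruction a b" and ?J = "span {Y u n (obstruction a b) | u n. True}"
  have c: "?c \<in> P 0" using obstruction_weight[OF a b] weight_3_even by auto
  have vac: "vac \<noteq> 0"
  proof
    assume "vac = 0"
    then have "v = 0" for v :: 'a using creation[of v] by simp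
    then show False using simple unfolding vosa_simple_def by auto
  qed
  have "u \<in> {u. Y u n ?c \<in> nonvacuum_part}" for u n
  proof (rule subspace_contains_by_parity)
    show "u \<in> {u. Y u n ?c \<in> nonvacuum_part}" if "u \<in> P \<alpha>" for u \<alpha>
      using skew_symmetry_in_stable_subspace[OF c that subspace_nonvacuum_part
          L_minus1_in_nonvacuum_part obstruction_modes_in_nonvacuum_part[OF a b]] by simp
  qed (rule subspace_mode_preimage_left[OF subspace_nonvacuum_part])
  then have "?J \<subseteq> nonvacuum_part"
    by (intro span_minimal subspace_nonvacuum_part) auto
  then have "?J \<noteq> UNIV" using vac_notin_nonvacuum_part[OF vac] by auto
  then have "?J = {0}"
    using simple ideal_generated_by_homogeneous[OF c] unfolding vosa_simple_def by blast
  moreover have "Y vac (- 1) ?c \<in> ?J" by (rule span_base) blast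
  ultimately show ?thesis by (simp add: vac_mode)
qed

end

theorem proposition3p22:
  fixes scale :: "complex \<Rightarrow> 'v::ab_group_add \<Rightarrow> 'v"
    and V :: "rat \<Rightarrow> 'v set"
    and Y :: "'v \<Rightarrow> int \<Rightarrow> 'v \<Rightarrow> 'v"
    and vac \<omega> :: 'v
  assumes "vertex_operator_superalgebra scale V Y vac \<omega>"
    and "vosa_simple scale Y"
    and "strongly_generates scale Y vac {x + y | x y. x \<in> V (3/2) \<and> y \<in> V 2}"
  shows "\<forall>a\<in>V 2. \<forall>b\<in>V 2. Y a 0 b = scale (1/2) (Vir Y \<omega> (- 1) (Y a 1 b))"
proof -
  interpret simple_vosa_low_generated scale V Y vac \<omega>
    using assms by (intro simple_vosa_low_generated.intro simple_vosa_low_generated_axioms.intro)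
  show ?thesis
    using obstruction_zero unfolding obstruction_def by simp
qed

end
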